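(* Let $M_0\in\mathbb{R}^{n\times n}$ be a symmetric diagonally dominant M-matrix (SDDM) with condition number $\kappa$ and associated weighted graph $\mathcal{G}$ on nodes $v_1,\dots,v_n$, let $b_0\in\mathbb{R}^n$, and let $\epsilon\in(0,\tfrac12]$. There exists a distributed algorithm $\mathcal{A}(\{[M_0]_{k1},\dots,[M_0]_{kn}\},[b_0]_k,\epsilon)$, in which node $v_k$ receives as input the $k$-th row of $M_0$, the $k$-th component $[b_0]_k$ of $b_0$ and the precision $\epsilon$, that computes an $\epsilon$-approximate solution of $M_0x=b_0$ (node $v_k$ outputting its $k$-th component) in $$\mathcal{O}\left(n^2\,\log\kappa\,\log\left(\tfrac1\epsilon\right)\right)$$ time steps.
   Context: SDDM: $M_0$ is symmetric positive definite with non-positive off-diagonal entries and $[M_0]_{ii}\ge-\sum_{j\ne i}[M_0]_{ij}$ for all $i$. Associated graph $\mathcal{G}=(\mathcal{V},\mathcal{E},W)$: nodes $v_1,\dots,v_n$, with $v_i,v_j$ ($i\neq j$) joined by an edge iff $W_{ij}:=-[M_0]_{ij}>0$. Condition number: $\kappa=|\lambda_{\max}(M_0)/\lambda_{\min}(M_0)|$. $\epsilon$-approximate solution: with $x^\star$ the solution of $M_0x=b_0$, a vector $\tilde x$ with $\|x^\star-\tilde x\|_{M_0}\le\epsilon\|x^\star\|_{M_0}$, where $\|u\|_{M_0}^2=u^{\mathsf T}M_0u$. Computational model: each node of $\mathcal{G}$ is a processor with its own memory, and all nodes work in parallel, exchanging data by message passing along edges of $\mathcal{G}$ (full communication: a node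 may obtain data from nodes at any distance). The number of time steps counts the arithmetic operations performed by a node plus the communication cost, where gathering data from nodes at distance at most $r$ costs $\mathcal{O}(r)$.
   Formalization: The factor log κ is replaced by max(1, log κ), since for κ = 1 (e.g. every n = 1 instance) the stated bound would be zero time steps, which is impossible; for κ bounded away from 1 the stated bound follows. *)

theory Defs
  imports "Jordan_Normal_Form.Char_Poly"
begin

section \<open>SDDM systems\<close>

definition spd :: "nat \<Rightarrow> real mat \<Rightarrow> bool" where
  "spd n M \<longleftrightarrow> M \<in> carrier_mat n n \<and> transpose_mat M = M \<and>
     (\<forall>u \<in> carrier_vec n. u \<noteq> 0\<^sub>v n \<longrightarrow> u \<bullet> (M *\<^sub>v u) > 0)"

definition sddm :: "nat \<Rightarrow> real mat \<Rightarrow> bool" where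
  "sddm n M \<longleftrightarrow> spd n M \<and>
     (\<forall>i<n. \<forall>j<n. i \<noteq> j \<longrightarrow> M $$ (i, j) \<le> 0) \<and>
     (\<forall>i<n. M $$ (i, i) \<ge> - (\<Sum>j \<in> {..<n} - {i}. M $$ (i, j)))"

text \<open>The eigenvalues of a real symmetric matrix are all real, so the set below is the whole
  spectrum.\<close>

definition condition_number :: "real mat \<Rightarrow> real" where
  "condition_number M = \<bar>Max {l. eigenvalue M l} / Min {l. eigenvalue M l}\<bar>"

definition energy_norm :: "real mat \<Rightarrow> real vec \<Rightarrow> real" where
  "energy_norm M u = sqrt (u \<bullet> (M *\<^sub>v u))"

definition approx_solution :: "nat \<Rightarrow> real mat \<Rightarrow> real vec \<Rightarrow> real \<Rightarrow> real vec \<Rightarrow> bool" where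
  "approx_solution n M b \<epsilon> y \<longleftrightarrow> y \<in> carrier_vec n \<and>
     (\<exists>x \<in> carrier_vec n. M *\<^sub>v x = b \<and> energy_norm M (x - y) \<le> \<epsilon> * energy_norm M x)"

text \<open>Nodes are numbered \<open>0, \<dots>, n - 1\<close>. The weight of the edge between \<open>i\<close> and \<open>j\<close> is
  \<open>- M $$ (i, j)\<close>.\<close>

definition edges :: "nat \<Rightarrow> real mat \<Rightarrow> (nat \<times> nat) set" where
  "edges n M = {(i, j). i < n \<and> j < n \<and> i \<noteq> j \<and> - M $$ (i, j) > 0}"

definition within_distance :: "nat \<Rightarrow> real mat \<Rightarrow> nat \<Rightarrow> nat \<Rightarrow> nat \<Rightarrow> bool" where
  "within_distance n M r i j \<longleftrightarrow> (\<exists>m\<le>r. (i, j) \<in> edges n M ^^ m)"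

section \<open>Local computation\<close>

text \<open>
  Each processor is a random access machine with exact real arithmetic. All processors run the
  same finite program, which may not depend on the instance (in particular not on \<open>n\<close>); its
  real constants are rational. A processor's memory consists of natural-number registers
  (counters, indices), arrays of reals, and a read-only inbox. The inbox holds the copies of
  other processors' arrays obtained by the latest gathering of data: \<open>inbox s j\<close> are the arrays
  of node \<open>j\<close>.
\<close>

type_synonym vname = string
type_synonym arrays = "vname \<Rightarrow> nat \<Rightarrow> real"

record store =
  nvar :: "vname \<Rightarrow> nat"
  arr :: arrays
  inbox :: "nat \<Rightarrow> arrays"

datatype nexp =
    NConst nat
  | NVar vname
  | NAdd nexp nexp
  | NSub nexp nexp
  | NMul nexp nexp

datatype rexp =
    RConst rat
  | Cell vname nexp
  | Recv nexp vname nexp  \<comment> \<open>sender, array, index\<close>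
  | RAdd rexp rexp
  | RSub rexp rexp
  | RMul rexp rexp
  | RDiv rexp rexp

datatype bexp =
    NLess nexp nexp
  | RLess rexp rexp
  | Not bexp
  | And bexp bexp

datatype com =
    Skip
  | NAssign vname nexp
  | RAssign vname nexp rexp  \<comment> \<open>array, index, value\<close>
  | Seq com com
  | If bexp com com
  | While bexp com

text \<open>\<open>NSub\<close> is truncated subtraction and division by zero yields zero; a program can test for
  both exceptions beforehand in a constant number of steps.\<close>

primrec nval :: "nexp \<Rightarrow> store \<Rightarrow> nat" where
  "nval (NConst m) s = m"
| "nval (NVar v) s = nvar s v"
| "nval (NAdd a b) s = nval a s + nval b s"
| "nval (NSub a b) s = nval a s - nval b s"
| "nval (NMul a b) s = nval a s * nval b s"

primrec rval :: "rexp \<Rightarrow> store \<Rightarrow> real" where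
  "rval (RConst q) s = of_rat q"
| "rval (Cell x a) s = arr s x (nval a s)"
| "rval (Recv j x a) s = inbox s (nval j s) x (nval a s)"
| "rval (RAdd e f) s = rval e s + rval f s"
| "rval (RSub e f) s = rval e s - rval f s"
| "rval (RMul e f) s = rval e s * rval f s"
| "rval (RDiv e f) s = rval e s / rval f s"

primrec bval :: "bexp \<Rightarrow> store \<Rightarrow> bool" where
  "bval (NLess a b) s \<longleftrightarrow> nval a s < nval b s"
| "bval (RLess e f) s \<longleftrightarrow> rval e s < rval f s"
| "bval (Not c) s \<longleftrightarrow> \<not> bval c s"
| "bval (And c d) s \<longleftrightarrow> bval c s \<and> bval d s"

text \<open>Every arithmetic operation, comparison, logical connective, constant and memory access
  (including reads from the inbox) costs one time step.\<close>

primrec ncost :: "nexp \<Rightarrow> nat" where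
  "ncost (NConst m) = 1"
| "ncost (NVar v) = 1"
| "ncost (NAdd a b) = 1 + ncost a + ncost b"
| "ncost (NSub a b) = 1 + ncost a + ncost b"
| "ncost (NMul a b) = 1 + ncost a + ncost b"

primrec rcost :: "rexp \<Rightarrow> nat" where
  "rcost (RConst q) = 1"
| "rcost (Cell x a) = 1 + ncost a"
| "rcost (Recv j x a) = 1 + ncost j + ncost a"
| "rcost (RAdd e f) = 1 + rcost e + rcost f"
| "rcost (RSub e f) = 1 + rcost e + rcost f"
| "rcost (RMul e f) = 1 + rcost e + rcost f"
| "rcost (RDiv e f) = 1 + rcost e + rcost f"

primrec bcost :: "bexp \<Rightarrow> nat" where
  "bcost (NLess a b) = 1 + ncost a + ncost b"
| "bcost (RLess e f) = 1 + rcost e + rcost f"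
| "bcost (Not c) = 1 + bcost c"
| "bcost (And c d) = 1 + bcost c + bcost d"

definition set_nvar :: "vname \<Rightarrow> nat \<Rightarrow> store \<Rightarrow> store" where
  "set_nvar v m s = s\<lparr>nvar := (nvar s)(v := m)\<rparr>"

definition set_cell :: "vname \<Rightarrow> nat \<Rightarrow> real \<Rightarrow> store \<Rightarrow> store" where
  "set_cell x i a s = s\<lparr>arr := (arr s)(x := (arr s x)(i := a))\<rparr>"

text \<open>\<open>exec c s t s'\<close>: started in \<open>s\<close>, the program \<open>c\<close> terminates in \<open>s'\<close> after \<open>t\<close> time steps.\<close>

inductive exec :: "com \<Rightarrow> store \<Rightarrow> nat \<Rightarrow> store \<Rightarrow> bool" where
  Skip: "exec Skip s 0 s"
| NAssign: "exec (NAssign v a) s (1 + ncost a) (set_nvar v (nval a s) s)"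
| RAssign: "exec (RAssign x a e) s (1 + ncost a + rcost e) (set_cell x (nval a s) (rval e s) s)"
| Seq: "exec c s t s' \<Longrightarrow> exec d s' u s'' \<Longrightarrow> exec (Seq c d) s (t + u) s''"
| IfTrue: "bval b s \<Longrightarrow> exec c s t s' \<Longrightarrow> exec (If b c d) s (bcost b + t) s'"
| IfFalse: "\<not> bval b s \<Longrightarrow> exec d s t s' \<Longrightarrow> exec (If b c d) s (bcost b + t) s'"
| WhileFalse: "\<not> bval b s \<Longrightarrow> exec (While b c) s (bcost b) s"
| WhileTrue: "bval b s \<Longrightarrow> exec c s t s' \<Longrightarrow> exec (While b c) s' u s'' \<Longrightarrow>
    exec (While b c) s (bcost b + t + u) s''"

section \<open>Distributed computation\<close>

text \<open>
  A distributed algorithm is a program that all nodes execute once per round on their own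
  memories. (Its behaviour may change from round to round by branching on a register that
  serves as program counter.) A round ends with the exchange of data: a node with value \<open>r\<close>
  in its register \<open>radius\<close> gathers the current arrays of the nodes at distance at most \<open>r\<close>
  from it in the graph, at a cost of \<open>r\<close> time steps; for all other nodes its inbox is zero.
  A node that has set its register \<open>halt\<close> no longer computes, but still forwards messages
  and its memory can still be gathered. As the nodes work in parallel, the duration of a round
  is the maximum over the nodes of local computation plus communication.
\<close>

type_synonym config = "nat \<Rightarrow> store"

definition halted :: "store \<Rightarrow> bool" where
  "halted s \<longleftrightarrow> nvar s ''halt'' \<noteq> 0"

definition gather :: "nat \<Rightarrow> real mat \<Rightarrow> config \<Rightarrow> nat \<Rightarrow> nat \<Rightarrow> arrays" where
  "gather n M \<sigma> k = (\<lambda>j. if j < n \<and> within_distance n M (nvar (\<sigma> k) ''radius'') k j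
                         then arr (\<sigma> j) else (\<lambda>_ _. 0))"

definition local_step :: "com \<Rightarrow> store \<Rightarrow> nat \<Rightarrow> store \<Rightarrow> bool" where
  "local_step A s t s' \<longleftrightarrow> (if halted s then t = 0 \<and> s' = s else exec A s t s')"

text \<open>\<open>\<tau>\<close> is the configuration after the local computations and \<open>t k\<close> their duration at node \<open>k\<close>.\<close>

definition round_step ::
  "nat \<Rightarrow> real mat \<Rightarrow> com \<Rightarrow> config \<Rightarrow> nat \<Rightarrow> config \<Rightarrow> bool" where
  "round_step n M A \<sigma> T \<sigma>' \<longleftrightarrow>
     (\<exists>t \<tau>. (\<forall>k<n. local_step A (\<sigma> k) (t k) (\<tau> k)) \<and>
        T = Max ((\<lambda>k. if halted (\<sigma> k) then 0 else t k + nvar (\<tau> k) ''radius'') ` {..<n}) \<and>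
        (\<forall>k<n. \<sigma>' k = (if halted (\<sigma> k) then \<sigma> k else (\<tau> k)\<lparr>inbox := gather n M \<tau> k\<rparr>)))"

text \<open>\<open>runs n M A \<sigma> T \<sigma>'\<close>: started in \<open>\<sigma>\<close>, the algorithm \<open>A\<close> reaches after \<open>T\<close> time steps the
  configuration \<open>\<sigma>'\<close>, in which all nodes have halted. The matrix \<open>M\<close> enters only through the
  communication graph.\<close>

inductive runs :: "nat \<Rightarrow> real mat \<Rightarrow> com \<Rightarrow> config \<Rightarrow> nat \<Rightarrow> config \<Rightarrow> bool"
  for n :: nat and M :: "real mat" and A :: com where
  finished: "\<forall>k<n. halted (\<sigma> k) \<Longrightarrow> runs n M A \<sigma> 0 \<sigma>"
| round: "\<not> (\<forall>k<n. halted (\<sigma> k)) \<Longrightarrow> round_step n M A \<sigma> T \<sigma>' \<Longrightarrow> runs n M A \<sigma>' U \<sigma>'' \<Longrightarrow>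
    runs n M A \<sigma> (T + U) \<sigma>''"

text \<open>Node \<open>k\<close> initially knows the length of its row, which entry of that row is the diagonal
  one (that is, its own name \<open>k\<close>), the row itself, its component of \<open>b\<close>, and \<open>\<epsilon>\<close>; scalars are
  kept in cell 0 of an array. It leaves its component of the result in cell 0 of the array
  \<open>x\<close>.\<close>

definition initial :: "nat \<Rightarrow> real mat \<Rightarrow> real vec \<Rightarrow> real \<Rightarrow> config" where
  "initial n M b \<epsilon> = (\<lambda>k.
     \<lparr>nvar = (\<lambda>_. 0)(''n'' := n, ''id'' := k),
      arr = (\<lambda>_ _. 0)(''M'' := (\<lambda>j. if j < n then M $$ (k, j) else 0),
                      ''b'' := (\<lambda>_. 0)(0 := b $ k),
                      ''eps'' := (\<lambda>_. 0)(0 := \<epsilon>)),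
      inbox = (\<lambda>_ _ _. 0)\<rparr>)"

definition result :: "nat \<Rightarrow> config \<Rightarrow> real vec" where
  "result n \<sigma> = vec n (\<lambda>k. arr (\<sigma> k) ''x'' 0)"

section \<open>Execution is deterministic\<close>

lemma exec_deterministic:
  "exec c s t s' \<Longrightarrow> exec c s u s'' \<Longrightarrow> t = u \<and> s' = s''"
proof (induction arbitrary: u s'' rule: exec.induct)
  case Skip then show ?case by (auto elim: exec.cases)
next
  case NAssign then show ?case by (auto elim: exec.cases)
next
  case RAssign then show ?case by (auto elim: exec.cases)
next
  case Seq from Seq.prems show ?case by cases (use Seq.IH in blast)
next
  case IfTrue from IfTrue.prems show ?case by cases (use IfTrue in blast)+
next
  case IfFalse from IfFalse.prems show ?case by cases (use IfFalse in blast)+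
next
  case WhileFalse from WhileFalse.prems show ?case by cases (use WhileFalse in auto)
next
  case WhileTrue from WhileTrue.prems show ?case by cases (use WhileTrue in blast)+
qed

lemma round_step_deterministic:
  assumes "round_step n M A \<sigma> T \<sigma>'" "round_step n M A \<rho> U \<rho>'" and eq: "\<forall>k<n. \<sigma> k = \<rho> k"
  shows "T = U \<and> (\<forall>k<n. \<sigma>' k = \<rho>' k)"
proof -
  obtain t \<tau> where 1: "\<forall>k<n. local_step A (\<sigma> k) (t k) (\<tau> k)"
    "T = Max ((\<lambda>k. if halted (\<sigma> k) then 0 else t k + nvar (\<tau> k) ''radius'') ` {..<n})"
    "\<forall>k<n. \<sigma>' k = (if halted (\<sigma> k) then \<sigma> k else (\<tau> k)\<lparr>inbox := gather n M \<tau> k\<rparr>)"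
    using assms(1) unfolding round_step_def by blast
  obtain u \<upsilon> where 2: "\<forall>k<n. local_step A (\<rho> k) (u k) (\<upsilon> k)"
    "U = Max ((\<lambda>k. if halted (\<rho> k) then 0 else u k + nvar (\<upsilon> k) ''radius'') ` {..<n})"
    "\<forall>k<n. \<rho>' k = (if halted (\<rho> k) then \<rho> k else (\<upsilon> k)\<lparr>inbox := gather n M \<upsilon> k\<rparr>)"
    using assms(2) unfolding round_step_def by blast
  have same: "t k = u k \<and> \<tau> k = \<upsilon> k" if "k < n" for k
    using 1(1) 2(1) eq that exec_deterministic by (fastforce simp: local_step_def split: if_splits)
  have "T = U"
    unfolding 1(2) 2(2) by (intro arg_cong[where f = Max] image_cong) (auto simp: eq same)
  moreover have "gather n M \<tau> k = gather n M \<upsilon> k" if "k < n" for k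
    using same that by (auto simp: gather_def fun_eq_iff)
  then have "\<forall>k<n. \<sigma>' k = \<rho>' k"
    using 1(3) 2(3) eq same by simp
  ultimately show ?thesis by blast
qed

lemma runs_deterministic:
  "runs n M A \<sigma> T \<sigma>' \<Longrightarrow> runs n M A \<rho> U \<rho>' \<Longrightarrow> \<forall>k<n. \<sigma> k = \<rho> k \<Longrightarrow>
    T = U \<and> result n \<sigma>' = result n \<rho>'"
proof (induction arbitrary: \<rho> U \<rho>' rule: runs.induct)
  case (finished \<sigma>)
  have "\<forall>k<n. halted (\<rho> k)"
    using finished.hyps finished.prems(2) by metis
  with finished.prems(1) have "U = 0" "\<rho>' = \<rho>"
    by (blast elim: runs.cases)+
  moreover have "result n \<sigma> = result n \<rho>"
    unfolding result_def using finished.prems(2) by (intro eq_vecI) simp_all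
  ultimately show ?case by simp
next
  case (round \<sigma> T \<sigma>' V \<sigma>'')
  have "\<not> (\<forall>k<n. halted (\<rho> k))"
    using round.hyps(1) round.prems(2) by metis
  with round.prems(1) obtain T' \<rho>1 V'
    where \<rho>: "U = T' + V'" "round_step n M A \<rho> T' \<rho>1" "runs n M A \<rho>1 V' \<rho>'"
    by (blast elim: runs.cases)
  have "T = T' \<and> (\<forall>k<n. \<sigma>' k = \<rho>1 k)"
    using round_step_deterministic[OF round.hyps(2) \<rho>(2) round.prems(2)] .
  then show ?case using \<rho>(1) round.IH[OF \<rho>(3)] by simp
qed

end

theory Submission
  imports Defs
begin

text \<open>
  The system is solved exactly, by Gauss--Jordan elimination with one row per node. For the
  elimination of column \<open>k\<close> every node gathers the rows of all nodes within distance \<open>n\<close>, at a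
  cost of \<open>n\<close> time steps, and subtracts a multiple of row \<open>k\<close> from its own, in \<open>O(n)\<close>
  operations. After \<open>n\<close> eliminations the matrix is diagonal and each node reads off its
  component. This takes \<open>O(n\<^sup>2)\<close> time steps in all, and the factors of the bound that depend
  on \<open>\<kappa>\<close> and \<open>\<epsilon>\<close> have the positive lower bounds \<open>1\<close> and \<open>ln 2\<close>.

  Two things need an argument. First, no pivoting must be needed. A zero pivot in step \<open>k\<close> would
  yield a vector \<open>u \<noteq> 0\<close>, supported on the indices up to \<open>k\<close>, that is annihilated by the
  first \<open>k + 1\<close> rows of the reduced matrix; by \<open>gauss_reduce_kernel\<close> the same rows of \<open>M\<close>
  annihilate it, so \<open>u \<bullet> M u = 0\<close>, which contradicts positive definiteness
  (\<open>gauss_reduce_diagonal\<close>). The same kernel lemma, applied to the augmented matrix, shows that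
  the final diagonal system has no solution other than that of the original one
  (\<open>gauss_reduce_solves\<close>).

  Second, a node sees only its own connected component of the graph, and within it only nodes at
  distance at most the radius. Radius \<open>n\<close> reaches the whole component (\<open>short_path\<close>). Rows of
  other components are received as zero, so that the multiplier becomes a quotient by zero, which
  is zero, and the row is left alone. That is the correct elimination step, because elimination
  creates no nonzero entries between different components (\<open>gauss_reduce_support\<close>).
\<close>

section \<open>Gauss--Jordan elimination without pivoting\<close>

text \<open>The pivot row is not normalised; the divisions by the diagonal entries are left to the end.
  The matrices are functions without bounds, so that a right-hand side can be carried along as
  an additional column.\<close>

definition pivot_step :: "nat \<Rightarrow> (nat \<Rightarrow> nat \<Rightarrow> real) \<Rightarrow> nat \<Rightarrow> nat \<Rightarrow> real" where
  "pivot_step k G i j = (if i = k then G i j else G i j - G i k / G k k * G k j)"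

primrec gauss_reduce :: "(nat \<Rightarrow> nat \<Rightarrow> real) \<Rightarrow> nat \<Rightarrow> nat \<Rightarrow> nat \<Rightarrow> real" where
  "gauss_reduce A 0 = A"
| "gauss_reduce A (Suc k) = pivot_step k (gauss_reduce A k)"

lemma gauss_reduce_Suc [simp]:
  "gauss_reduce A (Suc k) i j = (if i = k then gauss_reduce A k i j
     else gauss_reduce A k i j
       - gauss_reduce A k i k / gauss_reduce A k k k * gauss_reduce A k k j)"
  by (simp add: pivot_step_def)

declare gauss_reduce.simps(2) [simp del]

text \<open>An elimination step adds multiples of the pivot row to the other rows and leaves the pivot
  row itself unchanged, so it can be undone whatever the multipliers are. As only rows \<open>l < k\<close>
  have served as pivot rows, each of the first \<open>m \<ge> k\<close> rows of \<open>A\<close> is a combination of the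
  first \<open>m\<close> reduced rows.\<close>

lemma gauss_reduce_kernel:
  assumes "k \<le> m" and "\<And>i. i < m \<Longrightarrow> (\<Sum>j\<in>J. gauss_reduce A k i j * u j) = 0" and "i < m"
  shows "(\<Sum>j\<in>J. A i j * u j) = 0"
  using assms
proof (induction k arbitrary: i)
  case 0
  then show ?case by simp
next
  case (Suc k)
  let ?G = "gauss_reduce A k"
  have pivot: "(\<Sum>j\<in>J. ?G k j * u j) = 0"
    using Suc.prems(1) Suc.prems(2)[of k] by simp
  have "(\<Sum>j\<in>J. ?G l j * u j) = 0" if "l < m" for l
  proof (cases "l = k")
    case False
    have "0 = (\<Sum>j\<in>J. (?G l j - ?G l k / ?G k k * ?G k j) * u j)"
      using Suc.prems(2)[OF that] False by simp
    also have "\<dots> = (\<Sum>j\<in>J. ?G l j * u j) - ?G l k / ?G k k * (\<Sum>j\<in>J. ?G k j * u j)"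
      by (simp add: left_diff_distrib sum_subtractf sum_distrib_left mult.assoc)
    finally show ?thesis using pivot by simp
  qed (use pivot in simp)
  then show ?case using Suc.IH Suc.prems(1,3) by simp
qed

text \<open>A vanishing pivot would produce a nontrivial zero of the quadratic form.\<close>

lemma gauss_reduce_diagonal:
  assumes pd: "\<And>u. \<exists>i<n. u i \<noteq> 0 \<Longrightarrow> (\<Sum>i<n. u i * (\<Sum>j<n. A i j * u j)) \<noteq> (0 :: real)"
    and "k \<le> n"
  shows "(\<forall>l<k. gauss_reduce A k l l \<noteq> 0) \<and>
    (\<forall>i. \<forall>l<k. i \<noteq> l \<longrightarrow> gauss_reduce A k i l = 0)"
  using \<open>k \<le> n\<close>
proof (induction k)
  case 0
  then show ?case by simp
next
  case (Suc k)
  let ?G = "gauss_reduce A k"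
  have diag: "?G l l \<noteq> 0" if "l < k" for l using Suc that by simp
  have off: "?G i l = 0" if "l < k" "i \<noteq> l" for i l using Suc that by simp
  have "?G k k \<noteq> 0"
  proof
    assume zero: "?G k k = 0"
    \<comment> \<open>Back substitution through the diagonal block, with free variable \<open>u k = 1\<close>. Row \<open>k\<close>
        annihilates \<open>u\<close> as well, since its entries up to the diagonal are zero and \<open>u\<close> vanishes
        beyond.\<close>
    define u where "u j = (if j < k then - ?G j k / ?G j j else if j = k then 1 else 0)" for j
    have "(\<Sum>j<n. ?G i j * u j) = 0" if "i < Suc k" for i
    proof (cases "i = k")
      case True
      have "?G k j * u j = 0" for j
        using zero off[of j k] by (cases "j < k") (auto simp: u_def)
      then show ?thesis unfolding True by (intro sum.neutral ballI)
    next
      case False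
      then have "i < k" using that by simp
      have "(\<Sum>j<n. ?G i j * u j) = (\<Sum>j\<in>{i, k}. ?G i j * u j)"
        using \<open>i < k\<close> Suc.prems off[of _ i]
        by (intro sum.mono_neutral_right) (auto simp: u_def)
      also have "\<dots> = 0" using \<open>i < k\<close> diag[of i] by (simp add: u_def)
      finally show ?thesis .
    qed
    then have ker: "(\<Sum>j<n. A i j * u j) = 0" if "i \<le> k" for i
      using gauss_reduce_kernel[where k = k and m = "Suc k" and J = "{..<n}" and A = A and u = u] that by simp
    \<comment> \<open>The rows beyond \<open>k\<close> are not controlled, but there \<open>u\<close> itself vanishes.\<close>
    have "u i * (\<Sum>j<n. A i j * u j) = 0" for i
      using ker[of i] by (cases "i \<le> k") (auto simp: u_def)
    then have "(\<Sum>i<n. u i * (\<Sum>j<n. A i j * u j)) = 0"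
      by (intro sum.neutral ballI)
    moreover have "u k \<noteq> 0" "k < n" using Suc.prems by (auto simp: u_def)
    ultimately show False using pd by blast
  qed
  then show ?case using diag off by (auto simp: less_Suc_eq)
qed

text \<open>Column \<open>n\<close> holds the right-hand side: \<open>x\<close> solves the system iff the augmented matrix
  annihilates \<open>x\<close> extended by \<open>- 1\<close> at index \<open>n\<close>, so that the kernel lemma carries solutions
  of the diagonal system back to the original one.\<close>

lemma gauss_reduce_solves:
  assumes pd: "\<And>u. \<exists>i<n. u i \<noteq> 0 \<Longrightarrow> (\<Sum>i<n. u i * (\<Sum>j<n. A i j * u j)) \<noteq> (0 :: real)"
    and "i < n"
  shows "(\<Sum>j<n. A i j * (gauss_reduce A n j n / gauss_reduce A n j j)) = A i n"
proof -
  let ?G = "gauss_reduce A n"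
  define u where "u j = (if j < n then ?G j n / ?G j j else - 1)" for j
  note shape = gauss_reduce_diagonal[of n A n, OF pd order.refl]
  have "(\<Sum>j\<in>{..<Suc n}. ?G l j * u j) = 0" if "l < n" for l
  proof -
    have "(\<Sum>j\<in>{..<Suc n}. ?G l j * u j) = (\<Sum>j\<in>{l, n}. ?G l j * u j)"
      using that shape by (intro sum.mono_neutral_right) auto
    also have "\<dots> = 0" using that shape by (simp add: u_def)
    finally show ?thesis .
  qed
  then have "(\<Sum>j\<in>{..<Suc n}. A i j * u j) = 0"
    using gauss_reduce_kernel[where k = n and m = n] \<open>i < n\<close> by blast
  then show ?thesis by (simp add: u_def)
qed

text \<open>Fill-in at \<open>(i, j)\<close> arises from nonzero entries at \<open>(i, k)\<close> and \<open>(k, j)\<close>, so it stays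
  within any transitive relation that contains the original pattern.\<close>

lemma gauss_reduce_support:
  assumes "\<And>i j. i < n \<Longrightarrow> j < n \<Longrightarrow> \<not> R i j \<Longrightarrow> A i j = 0"
    and trans: "\<And>i k j. R i k \<Longrightarrow> R k j \<Longrightarrow> R i j"
    and "k \<le> n" "i < n" "j < n" "\<not> R i j"
  shows "gauss_reduce A k i j = 0"
  using assms(3-)
proof (induction k arbitrary: i j)
  case 0
  then show ?case using assms(1) by simp
next
  case (Suc k)
  then have "gauss_reduce A k i k = 0 \<or> gauss_reduce A k k j = 0"
    using trans[of i k j] by (metis Suc_le_lessD less_imp_le)
  then show ?case using Suc by auto
qed

section \<open>Distances in the communication graph\<close>

text \<open>The balls around \<open>i\<close> of radius \<open>0, 1, \<dots>\<close> grow strictly until one equals the next, and from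
  then on they are constant; as they have at most \<open>n\<close> elements, this happens by radius \<open>n\<close>.\<close>

lemma short_path:
  assumes "(i, j) \<in> (edges n M)\<^sup>*" and "i < n"
  shows "within_distance n M n i j"
proof -
  let ?E = "edges n M"
  define ball where "ball r = {j. within_distance n M r i j}" for r
  have target: "k < n" if "(i, k) \<in> ?E ^^ m" for k m
    using that \<open>i < n\<close> by (cases m) (auto simp: edges_def)
  then have sub: "ball r \<subseteq> {..<n}" for r
    unfolding ball_def within_distance_def by blast
  then have fin: "finite (ball r)" for r using finite_subset by blast
  have mono: "ball r \<subseteq> ball (Suc r)" for r
    unfolding ball_def within_distance_def using le_SucI by blast
  have step: "ball (Suc r) = ball r \<union> ?E `` ball r" for r
  proof
    show "ball (Suc r) \<subseteq> ball r \<union> ?E `` ball r"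
    proof
      fix k
      assume "k \<in> ball (Suc r)"
      then obtain m where m: "m \<le> Suc r" "(i, k) \<in> ?E ^^ m"
        unfolding ball_def within_distance_def by blast
      show "k \<in> ball r \<union> ?E `` ball r"
      proof (cases m)
        case 0
        then show ?thesis using m unfolding ball_def within_distance_def by blast
      next
        case (Suc m')
        then obtain l where "(i, l) \<in> ?E ^^ m'" "(l, k) \<in> ?E" using m by auto
        moreover have "m' \<le> r" using Suc m by simp
        ultimately show ?thesis unfolding ball_def within_distance_def by blast
      qed
    qed
    have "k \<in> ball (Suc r)" if "l \<in> ball r" "(l, k) \<in> ?E" for l k
    proof -
      obtain m where "m \<le> r" "(i, l) \<in> ?E ^^ m"
        using \<open>l \<in> ball r\<close> unfolding ball_def within_distance_def by blast
      then have "Suc m \<le> Suc r" "(i, k) \<in> ?E ^^ Suc m" using that(2) by auto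
      then show ?thesis unfolding ball_def within_distance_def by blast
    qed
    then show "ball r \<union> ?E `` ball r \<subseteq> ball (Suc r)" using mono by blast
  qed
  have "\<exists>r\<le>n. ball (Suc r) = ball r"
  proof (rule ccontr)
    assume "\<not> ?thesis"
    then have grows: "card (ball r) < card (ball (Suc r))" if "r \<le> n" for r
      using that mono[of r] fin psubset_card_mono[of "ball (Suc r)" "ball r"] by blast
    have "r \<le> Suc n \<Longrightarrow> r \<le> card (ball r)" for r
    proof (induction r)
      case (Suc r)
      then show ?case using grows[of r] by simp
    qed simp
    then have "Suc n \<le> card (ball (Suc n))" by blast
    then show False using card_mono[OF _ sub[of "Suc n"]] by simp
  qed
  then obtain r where r: "r \<le> n" "ball (Suc r) = ball r" by blast
  then have closed: "?E `` ball r \<subseteq> ball r" using step by blast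
  have "j \<in> ball r"
    using assms(1)
  proof (induction rule: rtrancl_induct)
    case base
    have "(i, i) \<in> ?E ^^ 0" by simp
    then show ?case unfolding ball_def within_distance_def by blast
  next
    case (step k l)
    then show ?case using closed by blast
  qed
  then show ?thesis using r(1) unfolding ball_def within_distance_def
    using order.trans by blast
qed

lemma within_distance_trans:
  assumes "within_distance n M n i k" "within_distance n M n k j" "i < n"
  shows "within_distance n M n i j"
proof (rule short_path)
  show "(i, j) \<in> (edges n M)\<^sup>*"
    using assms unfolding within_distance_def by (meson relpow_imp_rtrancl rtrancl_trans)
qed fact

section \<open>Timed total correctness\<close>

text \<open>A Hoare-style judgement for total correctness with a bound on the running time, in
  continuation-passing form: in the rule for sequences the postcondition of the first command is
  that the second one finishes. With schematic time bounds the rules compute the cost of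
  straight-line code.\<close>

definition finishes :: "com \<Rightarrow> store \<Rightarrow> nat \<Rightarrow> (store \<Rightarrow> bool) \<Rightarrow> bool" where
  "finishes c s T Q \<longleftrightarrow> (\<exists>t s'. exec c s t s' \<and> t \<le> T \<and> Q s')"

lemma finishes_weaken:
  "finishes c s T Q \<Longrightarrow> T \<le> T' \<Longrightarrow> (\<And>s'. Q s' \<Longrightarrow> Q' s') \<Longrightarrow> finishes c s T' Q'"
  unfolding finishes_def by (meson order.trans)

lemma finishes_le: "finishes c s T Q \<Longrightarrow> T \<le> T' \<Longrightarrow> finishes c s T' Q"
  by (rule finishes_weaken)

lemma finishes_Skip: "Q s \<Longrightarrow> finishes Skip s 0 Q"
  unfolding finishes_def using exec.Skip by blast

lemma finishes_NAssign:
  "Q (set_nvar v (nval a s) s) \<Longrightarrow> finishes (NAssign v a) s (1 + ncost a) Q"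
  unfolding finishes_def using exec.NAssign by blast

lemma finishes_RAssign:
  "Q (set_cell x (nval a s) (rval e s) s) \<Longrightarrow>
    finishes (RAssign x a e) s (1 + ncost a + rcost e) Q"
  unfolding finishes_def using exec.RAssign by blast

lemma finishes_Seq:
  "finishes c s T (\<lambda>s'. finishes d s' U Q) \<Longrightarrow> finishes (Seq c d) s (T + U) Q"
  unfolding finishes_def by (meson exec.Seq add_mono)

lemma finishes_If:
  assumes "bval b s \<Longrightarrow> finishes c s T Q" and "\<not> bval b s \<Longrightarrow> finishes d s U Q"
  shows "finishes (If b c d) s (bcost b + max T U) Q"
proof (cases "bval b s")
  case True
  then obtain t s' where "exec c s t s'" "t \<le> T" "Q s'"
    using assms(1) unfolding finishes_def by blast
  then show ?thesis
    unfolding finishes_def using exec.IfTrue[OF True]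
    by (meson add_left_mono max.coboundedI1)
next
  case False
  then obtain t s' where "exec d s t s'" "t \<le> U" "Q s'"
    using assms(2) unfolding finishes_def by blast
  then show ?thesis
    unfolding finishes_def using exec.IfFalse[OF False]
    by (meson add_left_mono max.coboundedI2)
qed

lemma finishes_While_False: "\<not> bval b s \<Longrightarrow> Q s \<Longrightarrow> finishes (While b c) s (bcost b) Q"
  unfolding finishes_def using exec.WhileFalse by blast

lemma finishes_While_True:
  "bval b s \<Longrightarrow> finishes c s T (\<lambda>s'. finishes (While b c) s' U Q) \<Longrightarrow>
    finishes (While b c) s (bcost b + T + U) Q"
  unfolding finishes_def by (meson exec.WhileTrue add_mono add_left_mono)

lemmas finishes_rules =
  finishes_Skip finishes_NAssign finishes_RAssign finishes_Seq finishes_If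

section \<open>The program\<close>

text \<open>In round \<open>r > 0\<close> the pivot is \<open>r - 1\<close>; round \<open>0\<close> serves only to have the rows gathered for the
  first time. The right-hand side stays in cell \<open>0\<close> of array \<open>b\<close>. The multiplier is saved in
  array \<open>f\<close> before the loop overwrites the entry from which it is computed.\<close>

abbreviation "pivot_index \<equiv> NSub (NVar ''round'') (NConst 1)"

abbreviation "differ a b \<equiv> Not (And (Not (NLess a b)) (Not (NLess b a)))"

definition subtract_entries :: com where
  "subtract_entries =
     While (NLess (NVar ''j'') (NVar ''n''))
       (Seq (RAssign ''M'' (NVar ''j'')
               (RSub (Cell ''M'' (NVar ''j''))
                  (RMul (Cell ''f'' (NConst 0)) (Recv pivot_index ''M'' (NVar ''j'')))))
            (NAssign ''j'' (NAdd (NVar ''j'') (NConst 1))))"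

definition eliminate :: com where
  "eliminate =
     Seq (RAssign ''f'' (NConst 0)
            (RDiv (Cell ''M'' pivot_index) (Recv pivot_index ''M'' pivot_index)))
    (Seq (NAssign ''j'' (NConst 0))
    (Seq subtract_entries
         (RAssign ''b'' (NConst 0)
            (RSub (Cell ''b'' (NConst 0))
               (RMul (Cell ''f'' (NConst 0)) (Recv pivot_index ''b'' (NConst 0)))))))"

definition finish_round :: com where
  "finish_round =
     Seq (If (NLess (NVar ''round'') (NVar ''n'')) Skip
            (Seq (RAssign ''x'' (NConst 0)
                    (RDiv (Cell ''b'' (NConst 0)) (Cell ''M'' (NVar ''id''))))
                 (NAssign ''halt'' (NConst 1))))
    (Seq (NAssign ''radius'' (NVar ''n''))
         (NAssign ''round'' (NAdd (NVar ''round'') (NConst 1))))"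

definition program :: com where
  "program =
     Seq (If (And (NLess (NConst 0) (NVar ''round'')) (differ (NVar ''id'') pivot_index))
            eliminate Skip)
      finish_round"

text \<open>The store in which the loop over the entries ends, as a function of the store at any
  of its iterations. It does not change from one iteration to the next, which makes it the loop
  invariant.\<close>

definition row_updated :: "store \<Rightarrow> store" where
  "row_updated s = s\<lparr>
     nvar := (nvar s)(''j'' := nvar s ''n''),
     arr := (arr s)(''M'' := (\<lambda>l. if nvar s ''j'' \<le> l \<and> l < nvar s ''n''
       then arr s ''M'' l - arr s ''f'' 0 * inbox s (nvar s ''round'' - 1) ''M'' l
       else arr s ''M'' l))\<rparr>"

lemma subtract_entries_correct:
  assumes "nvar s ''j'' \<le> nvar s ''n''"
  shows "finishes subtract_entries s (3 + 20 * (nvar s ''n'' - nvar s ''j'')) (\<lambda>s'. s' = row_updated s)"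
  using assms
proof (induction "nvar s ''n'' - nvar s ''j''" arbitrary: s)
  case 0
  then have "nvar s ''j'' = nvar s ''n''" by simp
  then show ?case
    unfolding subtract_entries_def row_updated_def
    by (intro finishes_weaken[OF finishes_While_False[where Q = "\<lambda>s'. s' = s"]])
      (auto intro!: store.equality simp: fun_eq_iff)
next
  case (Suc d)
  define s1 where "s1 = set_nvar ''j'' (nvar s ''j'' + 1) (set_cell ''M'' (nvar s ''j'')
    (arr s ''M'' (nvar s ''j'') - arr s ''f'' 0 * inbox s (nvar s ''round'' - 1) ''M'' (nvar s ''j'')) s)"
  have less: "nvar s ''j'' < nvar s ''n''" using Suc.hyps(2) by simp
  have s1: "nvar s1 ''n'' = nvar s ''n''" "nvar s1 ''j'' = nvar s ''j'' + 1"
    by (simp_all add: s1_def set_nvar_def set_cell_def)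
  have "row_updated s1 = row_updated s"
    using less by (auto simp: row_updated_def s1_def set_nvar_def set_cell_def fun_eq_iff)
  then have rest: "finishes subtract_entries s1 (3 + 20 * (nvar s1 ''n'' - nvar s1 ''j''))
      (\<lambda>s'. s' = row_updated s)"
    using Suc.hyps(1)[of s1] Suc.hyps(2) s1 by simp
  have body: "finishes (Seq (RAssign ''M'' (NVar ''j'')
               (RSub (Cell ''M'' (NVar ''j''))
                  (RMul (Cell ''f'' (NConst 0)) (Recv pivot_index ''M'' (NVar ''j'')))))
            (NAssign ''j'' (NAdd (NVar ''j'') (NConst 1)))) s 17 (\<lambda>s'. s' = s1)"
    by (rule finishes_le, (rule finishes_rules)+)
      (simp_all add: s1_def set_nvar_def set_cell_def)
  show ?case
    unfolding subtract_entries_def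
  proof (rule finishes_le[OF finishes_While_True])
    show "bval (NLess (NVar ''j'') (NVar ''n'')) s" using less by simp
  qed (rule finishes_weaken[OF body order.refl], use rest in \<open>simp add: subtract_entries_def\<close>,
      use less s1 in simp)
qed

lemma eliminate_correct:
  fixes s :: store
  defines "p \<equiv> nvar s ''round'' - 1"
  shows "finishes eliminate s (32 + 20 * nvar s ''n'') (\<lambda>s'.
    (\<forall>v. v \<noteq> ''j'' \<longrightarrow> nvar s' v = nvar s v) \<and>
    (\<forall>l<nvar s ''n''. arr s' ''M'' l =
       arr s ''M'' l - arr s ''M'' p / inbox s p ''M'' p * inbox s p ''M'' l) \<and>
    arr s' ''b'' 0 = arr s ''b'' 0 - arr s ''M'' p / inbox s p ''M'' p * inbox s p ''b'' 0)"
  unfolding eliminate_def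
  by (rule finishes_le, (rule finishes_Seq finishes_RAssign finishes_NAssign)+,
      rule finishes_weaken[OF subtract_entries_correct], simp add: set_nvar_def, rule order.refl,
      rule finishes_RAssign)
    (simp_all add: row_updated_def set_nvar_def set_cell_def p_def)

text \<open>A round in which the node does not eliminate is described uniformly by the multiplier
  \<open>f = 0\<close>.\<close>

lemma program_correct:
  fixes s :: store
  defines "n \<equiv> nvar s ''n''" and "i \<equiv> nvar s ''id''" and "r \<equiv> nvar s ''round''"
  defines "f \<equiv> (if 0 < r \<and> i \<noteq> r - 1 then arr s ''M'' (r - 1) / inbox s (r - 1) ''M'' (r - 1) else 0)"
  assumes "\<not> halted s"
  shows "finishes program s (100 + 20 * n) (\<lambda>s'.
    nvar s' ''n'' = n \<and> nvar s' ''id'' = i \<and> nvar s' ''round'' = r + 1 \<and>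
    nvar s' ''radius'' = n \<and> (halted s' \<longleftrightarrow> n \<le> r) \<and>
    (\<forall>l<n. arr s' ''M'' l = arr s ''M'' l - f * inbox s (r - 1) ''M'' l) \<and>
    arr s' ''b'' 0 = arr s ''b'' 0 - f * inbox s (r - 1) ''b'' 0 \<and>
    (n \<le> r \<longrightarrow> arr s' ''x'' 0 = arr s' ''b'' 0 / arr s' ''M'' i))"
proof -
  define Q where "Q s' \<longleftrightarrow> (\<forall>v. v \<noteq> ''j'' \<longrightarrow> nvar s' v = nvar s v) \<and>
    (\<forall>l<n. arr s' ''M'' l = arr s ''M'' l - f * inbox s (r - 1) ''M'' l) \<and>
    arr s' ''b'' 0 = arr s ''b'' 0 - f * inbox s (r - 1) ''b'' 0" for s' :: store
  have elimination: "finishes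
    (If (And (NLess (NConst 0) (NVar ''round'')) (differ (NVar ''id'') pivot_index)) eliminate Skip)
    s (52 + 20 * n) Q"
  proof (rule finishes_le[OF finishes_If])
    assume "bval (And (NLess (NConst 0) (NVar ''round'')) (differ (NVar ''id'') pivot_index)) s"
    then have "f = arr s ''M'' (r - 1) / inbox s (r - 1) ''M'' (r - 1)"
      by (auto simp: f_def i_def r_def)
    then show "finishes eliminate s (32 + 20 * n) Q"
      unfolding Q_def n_def r_def using eliminate_correct[of s] by simp
  next
    assume "\<not> bval (And (NLess (NConst 0) (NVar ''round'')) (differ (NVar ''id'') pivot_index)) s"
    then have "f = 0" by (auto simp: f_def i_def r_def)
    then show "finishes Skip s 0 Q" by (intro finishes_Skip) (simp add: Q_def)
  qed simp
  have finish: "finishes finish_round s' 18 (\<lambda>s'.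
    nvar s' ''n'' = n \<and> nvar s' ''id'' = i \<and> nvar s' ''round'' = r + 1 \<and>
    nvar s' ''radius'' = n \<and> (halted s' \<longleftrightarrow> n \<le> r) \<and>
    (\<forall>l<n. arr s' ''M'' l = arr s ''M'' l - f * inbox s (r - 1) ''M'' l) \<and>
    arr s' ''b'' 0 = arr s ''b'' 0 - f * inbox s (r - 1) ''b'' 0 \<and>
    (n \<le> r \<longrightarrow> arr s' ''x'' 0 = arr s' ''b'' 0 / arr s' ''M'' i))" if "Q s'" for s'
    unfolding finish_round_def
    by (rule finishes_le, ((rule finishes_rules)+, use that \<open>\<not> halted s\<close> in
      \<open>simp add: Q_def set_nvar_def set_cell_def n_def i_def r_def halted_def\<close>)+) simp
  show ?thesis
    unfolding program_def
    by (rule finishes_le, rule finishes_Seq, rule finishes_weaken[OF elimination order.refl],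
        erule finish) simp
qed

section \<open>The distributed run\<close>

definition system :: "nat \<Rightarrow> real mat \<Rightarrow> real vec \<Rightarrow> nat \<Rightarrow> nat \<Rightarrow> real" where
  "system n M b i j = (if j < n then M $$ (i, j) else b $ i)"

text \<open>The configuration before round \<open>r\<close>, when \<open>r - 1\<close> eliminations have been carried out (none
  for \<open>r = 0\<close>, by truncated subtraction). The inbox holds rows of the same stage, those of
  unreachable nodes replaced by zero; before round \<open>0\<close> nothing has been received.\<close>

definition on_schedule :: "nat \<Rightarrow> real mat \<Rightarrow> real vec \<Rightarrow> nat \<Rightarrow> config \<Rightarrow> bool" where
  "on_schedule n M b r \<sigma> \<longleftrightarrow> (\<forall>i<n.
     let G = gauss_reduce (system n M b) (r - 1); s = \<sigma> i in
     nvar s ''n'' = n \<and> nvar s ''id'' = i \<and> nvar s ''round'' = r \<and> (halted s \<longleftrightarrow> n < r) \<and>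
     (\<forall>j<n. arr s ''M'' j = G i j) \<and> arr s ''b'' 0 = G i n \<and>
     (0 < r \<longrightarrow> (\<forall>k<n. let known = (if within_distance n M n i k then 1 else 0) in
        (\<forall>j<n. inbox s k ''M'' j = known * G k j) \<and> inbox s k ''b'' 0 = known * G k n)) \<and>
     (n < r \<longrightarrow> arr s ''x'' 0 = G i n / G i i))"

lemma on_schedule_initial: "on_schedule n M b 0 (initial n M b \<epsilon>)"
  by (simp add: on_schedule_def initial_def halted_def system_def)

text \<open>Within distance \<open>n\<close> means in the same component, and a nonzero off-diagonal entry of an
  SDDM matrix is negative, that is, an edge.\<close>

lemma gauss_reduce_system_local:
  assumes "sddm n M" "k \<le> n" "i < n" "j < n" "\<not> within_distance n M n i j"
  shows "gauss_reduce (system n M b) k i j = 0"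
proof (rule gauss_reduce_support[where R = "\<lambda>i j. i < n \<and> within_distance n M n i j"])
  fix i j
  assume ij: "i < n" "j < n" "\<not> (i < n \<and> within_distance n M n i j)"
  have "i \<noteq> j \<and> (i, j) \<notin> edges n M"
    using ij short_path[of i j n M] by auto
  then show "system n M b i j = 0"
    using \<open>sddm n M\<close> ij unfolding sddm_def edges_def system_def by force
qed (use assms within_distance_trans in blast)+

lemma round_on_schedule:
  assumes "sddm n M" "1 \<le> n" "r \<le> n" and sched: "on_schedule n M b r \<sigma>"
  shows "\<exists>T \<sigma>'. round_step n M program \<sigma> T \<sigma>' \<and> T \<le> 121 * n \<and> on_schedule n M b (Suc r) \<sigma>'"
proof -
  let ?G = "gauss_reduce (system n M b)"
  let ?R = "within_distance n M n"
  have node: "nvar (\<sigma> i) ''n'' = n" "nvar (\<sigma> i) ''id'' = i" "nvar (\<sigma> i) ''round'' = r"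
    "\<not> halted (\<sigma> i)" "\<forall>j<n. arr (\<sigma> i) ''M'' j = ?G (r - 1) i j" "arr (\<sigma> i) ''b'' 0 = ?G (r - 1) i n"
    if "i < n" for i
    using sched \<open>r \<le> n\<close> that unfolding on_schedule_def Let_def by auto
  have received: "\<forall>j<n. inbox (\<sigma> i) (r - 1) ''M'' j = (if ?R i (r - 1) then 1 else 0) * ?G (r - 1) (r - 1) j"
    "inbox (\<sigma> i) (r - 1) ''b'' 0 = (if ?R i (r - 1) then 1 else 0) * ?G (r - 1) (r - 1) n"
    if "i < n" "0 < r" for i
    using sched \<open>r \<le> n\<close> that unfolding on_schedule_def Let_def by auto
  define P where "P i s \<longleftrightarrow> nvar s ''n'' = n \<and> nvar s ''id'' = i \<and> nvar s ''round'' = Suc r \<and>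
     nvar s ''radius'' = n \<and> (halted s \<longleftrightarrow> n < Suc r) \<and>
     (\<forall>j<n. arr s ''M'' j = ?G r i j) \<and> arr s ''b'' 0 = ?G r i n \<and>
     (n < Suc r \<longrightarrow> arr s ''x'' 0 = ?G r i n / ?G r i i)" for i s
  have "\<exists>t s'. exec program (\<sigma> i) t s' \<and> t \<le> 120 * n \<and> P i s'" if "i < n" for i
  proof -
    define f where "f = (if 0 < r \<and> i \<noteq> r - 1
      then arr (\<sigma> i) ''M'' (r - 1) / inbox (\<sigma> i) (r - 1) ''M'' (r - 1) else 0)"
    \<comment> \<open>If node \<open>r - 1\<close> is out of reach, then \<open>f\<close> is a quotient by zero and thus zero; the exact
        multiplier is zero too, since its numerator is.\<close>
    have eliminated: "?G (r - 1) i j - f * inbox (\<sigma> i) (r - 1) x l = ?G r i j"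
      if "0 < r \<Longrightarrow> inbox (\<sigma> i) (r - 1) x l = (if ?R i (r - 1) then 1 else 0) * ?G (r - 1) (r - 1) j"
      for j x l
    proof (cases r)
      case 0
      then show ?thesis by (simp add: f_def)
    next
      case (Suc k)
      then have "k < n" using \<open>r \<le> n\<close> by simp
      then have "?G k i k = 0" if "\<not> ?R i k"
        using gauss_reduce_system_local[OF \<open>sddm n M\<close> _ \<open>i < n\<close> _ that] by simp
      then show ?thesis
        using Suc that node(5)[OF \<open>i < n\<close>] received(1)[OF \<open>i < n\<close>] \<open>k < n\<close>
        by (auto simp: f_def)
    qed
    have M: "arr (\<sigma> i) ''M'' j - f * inbox (\<sigma> i) (r - 1) ''M'' j = ?G r i j" if "j < n" for j
      using eliminated[of "''M''" j j] received(1)[OF \<open>i < n\<close>] node(5)[OF \<open>i < n\<close>] that by simp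
    have b: "arr (\<sigma> i) ''b'' 0 - f * inbox (\<sigma> i) (r - 1) ''b'' 0 = ?G r i n"
      using eliminated[of "''b''" 0 n] received(2)[OF \<open>i < n\<close>] node(6)[OF \<open>i < n\<close>] by simp
    have "finishes program (\<sigma> i) (120 * n) (P i)"
      using program_correct[OF node(4)[OF \<open>i < n\<close>]] unfolding node(1-3)[OF \<open>i < n\<close>] f_def[symmetric]
      by (rule finishes_weaken) (use \<open>1 \<le> n\<close> \<open>i < n\<close> in \<open>simp_all add: P_def M[simplified] b[simplified] less_Suc_eq_le\<close>)
    then show ?thesis unfolding finishes_def .
  qed
  then obtain t \<tau> where
    run: "\<And>i. i < n \<Longrightarrow> exec program (\<sigma> i) (t i) (\<tau> i) \<and> t i \<le> 120 * n \<and> P i (\<tau> i)"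
    by metis
  let ?T = "Max ((\<lambda>k. if halted (\<sigma> k) then 0 else t k + nvar (\<tau> k) ''radius'') ` {..<n})"
  let ?\<sigma>' = "\<lambda>k. (\<tau> k)\<lparr>inbox := gather n M \<tau> k\<rparr>"
  have "round_step n M program \<sigma> ?T ?\<sigma>'"
    unfolding round_step_def local_step_def using run node(4) by (intro exI[of _ t] exI[of _ \<tau>]) simp
  moreover have "?T \<le> 121 * n"
  proof (rule Max.boundedI)
    fix a
    assume "a \<in> (\<lambda>k. if halted (\<sigma> k) then 0 else t k + nvar (\<tau> k) ''radius'') ` {..<n}"
    then obtain k where "k < n" "a \<le> t k + nvar (\<tau> k) ''radius''" by auto
    then show "a \<le> 121 * n" using run[of k] by (simp add: P_def)
  qed (use \<open>1 \<le> n\<close> in \<open>auto simp only: finite_imageI finite_lessThan image_is_empty lessThan_empty_iff\<close>)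
  moreover have "on_schedule n M b (Suc r) ?\<sigma>'"
    unfolding on_schedule_def Let_def
  proof (intro allI impI)
    fix i
    assume "i < n"
    have "gather n M \<tau> i k = (if ?R i k then arr (\<tau> k) else (\<lambda>_ _. 0))" if "k < n" for k
      using run[OF \<open>i < n\<close>] that by (simp add: gather_def P_def)
    moreover have "halted (?\<sigma>' i) = halted (\<tau> i)" by (simp add: halted_def)
    ultimately show "nvar (?\<sigma>' i) ''n'' = n \<and> nvar (?\<sigma>' i) ''id'' = i \<and> nvar (?\<sigma>' i) ''round'' = Suc r \<and>
      halted (?\<sigma>' i) = (n < Suc r) \<and>
      (\<forall>j<n. arr (?\<sigma>' i) ''M'' j = ?G (Suc r - 1) i j) \<and> arr (?\<sigma>' i) ''b'' 0 = ?G (Suc r - 1) i n \<and>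
      (0 < Suc r \<longrightarrow> (\<forall>k<n.
        (\<forall>j<n. inbox (?\<sigma>' i) k ''M'' j = (if ?R i k then 1 else 0) * ?G (Suc r - 1) k j) \<and>
        inbox (?\<sigma>' i) k ''b'' 0 = (if ?R i k then 1 else 0) * ?G (Suc r - 1) k n)) \<and>
      (n < Suc r \<longrightarrow> arr (?\<sigma>' i) ''x'' 0 = ?G (Suc r - 1) i n / ?G (Suc r - 1) i i)"
      using run \<open>i < n\<close> by (simp add: P_def)
  qed
  ultimately show ?thesis by blast
qed

text \<open>Round \<open>n\<close> performs the last elimination and halts, so there are \<open>n + 1\<close> rounds.\<close>

lemma program_runs:
  assumes "sddm n M" "1 \<le> n" "r \<le> Suc n" "on_schedule n M b r \<sigma>"
  shows "\<exists>T \<sigma>'. runs n M program \<sigma> T \<sigma>' \<and> T \<le> (Suc n - r) * (121 * n) \<and> on_schedule n M b (Suc n) \<sigma>'"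
  using assms(3,4)
proof (induction arbitrary: \<sigma> rule: inc_induct)
  case base
  then have "\<forall>k<n. halted (\<sigma> k)" unfolding on_schedule_def Let_def by auto
  then show ?case using base runs.finished[of n \<sigma>] by fastforce
next
  case (step r)
  then have "r \<le> n" by simp
  then obtain T \<sigma>1 where 1: "round_step n M program \<sigma> T \<sigma>1" "T \<le> 121 * n" "on_schedule n M b (Suc r) \<sigma>1"
    using round_on_schedule[OF assms(1,2)] step.prems by blast
  obtain U \<sigma>' where 2: "runs n M program \<sigma>1 U \<sigma>'" "U \<le> (Suc n - Suc r) * (121 * n)"
    "on_schedule n M b (Suc n) \<sigma>'"
    using step.IH[OF 1(3)] by blast
  have "0 < n" "\<not> halted (\<sigma> 0)"
    using step.prems \<open>r \<le> n\<close> \<open>1 \<le> n\<close> unfolding on_schedule_def Let_def by auto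
  then have "\<not> (\<forall>k<n. halted (\<sigma> k))" by blast
  then have "runs n M program \<sigma> (T + U) \<sigma>'" using runs.round 1(1) 2(1) by blast
  moreover have "T + U \<le> (Suc n - r) * (121 * n)"
    using 1(2) 2(2) \<open>r \<le> n\<close> by (simp add: Suc_diff_le)
  ultimately show ?case using 2(3) by blast
qed

lemma on_schedule_result:
  assumes "sddm n M" "b \<in> carrier_vec n" "on_schedule n M b (Suc n) \<sigma>"
  shows "M *\<^sub>v result n \<sigma> = b"
proof (rule eq_vecI)
  let ?A = "system n M b"
  have M: "M \<in> carrier_mat n n" using assms(1) by (simp add: sddm_def spd_def)
  have pd: "(\<Sum>i<n. u i * (\<Sum>j<n. ?A i j * u j)) \<noteq> 0" if "\<exists>i<n. u i \<noteq> 0" for u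
  proof -
    have "vec n u \<noteq> 0\<^sub>v n" using that by (metis index_vec index_zero_vec(1))
    then have "vec n u \<bullet> (M *\<^sub>v vec n u) > 0"
      using assms(1) by (simp add: sddm_def spd_def)
    also have "vec n u \<bullet> (M *\<^sub>v vec n u) = (\<Sum>i<n. u i * (\<Sum>j<n. ?A i j * u j))"
      using M by (simp add: scalar_prod_def system_def atLeast0LessThan)
    finally show ?thesis by simp
  qed
  fix i
  assume "i < dim_vec b"
  then have "i < n" using assms(2) by simp
  have "(M *\<^sub>v result n \<sigma>) $ i = (\<Sum>j<n. ?A i j * (gauss_reduce ?A n j n / gauss_reduce ?A n j j))"
    using M \<open>i < n\<close> assms(3)
    by (simp add: scalar_prod_def system_def result_def on_schedule_def Let_def atLeast0LessThan)
  also have "\<dots> = b $ i"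
    using gauss_reduce_solves[of n ?A i, OF pd \<open>i < n\<close>] by (simp add: system_def)
  finally show "(M *\<^sub>v result n \<sigma>) $ i = b $ i" .
qed (use assms in \<open>auto simp: sddm_def spd_def\<close>)

lemma exact_solution_approx:
  assumes "sddm n M" "y \<in> carrier_vec n" "M *\<^sub>v y = b" "0 < \<epsilon>"
  shows "approx_solution n M b \<epsilon> y"
proof -
  have M: "M \<in> carrier_mat n n" using assms(1) by (simp add: sddm_def spd_def)
  have "energy_norm M (y - y) = 0"
    using M assms(2) by (simp add: energy_norm_def)
  moreover have "0 \<le> energy_norm M y"
  proof (cases "y = 0\<^sub>v n")
    case False
    then show ?thesis using assms(1,2) by (simp add: energy_norm_def sddm_def spd_def less_imp_le)
  qed (use M in \<open>simp add: energy_norm_def\<close>)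
  ultimately show ?thesis
    using assms unfolding approx_solution_def by (intro conjI bexI[of _ y]) auto
qed

theorem theorem1:
  shows "\<exists>A :: com. \<exists>C > (0 :: real).
    \<forall>(n :: nat) (M :: real mat) (b :: real vec) (\<epsilon> :: real).
      n \<ge> 1 \<and> sddm n M \<and> b \<in> carrier_vec n \<and> 0 < \<epsilon> \<and> \<epsilon> \<le> 1/2 \<longrightarrow>
      (\<exists>T \<sigma>. runs n M A (initial n M b \<epsilon>) T \<sigma> \<and>
         approx_solution n M b \<epsilon> (result n \<sigma>) \<and>
         real T \<le> C * (real n)\<^sup>2 * max 1 (ln (condition_number M)) * ln (1 / \<epsilon>))"
  \<comment> \<open>\<open>n + 1 \<le> 2 * n\<close> rounds of at most \<open>121 * n\<close> steps each; the factor \<open>1 / ln 2\<close>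
      compensates for \<open>ln (1 / \<epsilon>)\<close>, which is at least \<open>ln 2\<close>.\<close>
proof (intro exI[of _ program] exI[of _ "242 / ln 2"] conjI allI impI)
  fix n :: nat and M :: "real mat" and b :: "real vec" and \<epsilon> :: real
  assume asm: "n \<ge> 1 \<and> sddm n M \<and> b \<in> carrier_vec n \<and> 0 < \<epsilon> \<and> \<epsilon> \<le> 1/2"
  then obtain T \<sigma> where run: "runs n M program (initial n M b \<epsilon>) T \<sigma>" "T \<le> Suc n * (121 * n)"
    "on_schedule n M b (Suc n) \<sigma>"
    using program_runs[OF _ _ _ on_schedule_initial] by (metis diff_zero le0)
  have "approx_solution n M b \<epsilon> (result n \<sigma>)"
    using asm on_schedule_result[OF _ _ run(3)]
    by (intro exact_solution_approx) (auto simp: result_def)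
  moreover have "real T \<le> 242 / ln 2 * (real n)\<^sup>2 * max 1 (ln (condition_number M)) * ln (1 / \<epsilon>)"
  proof -
    have "Suc n * (121 * n) \<le> (2 * n) * (121 * n)"
      using asm by (intro mult_right_mono) auto
    also have "\<dots> = 242 * n\<^sup>2" by (simp add: power2_eq_square)
    finally have "T \<le> 242 * n\<^sup>2" using run(2) by simp
    then have "real T \<le> 242 * (real n)\<^sup>2"
      by (metis of_nat_le_iff of_nat_mult of_nat_numeral of_nat_power)
    also have "\<dots> \<le> 242 * (real n)\<^sup>2 * (max 1 (ln (condition_number M)) * (ln (1 / \<epsilon>) / ln 2))"
    proof -
      have "2 \<le> 1 / \<epsilon>" using asm by (simp add: field_simps)
      then have "ln 2 \<le> ln (1 / \<epsilon>)" using ln_mono[of 2 "1 / \<epsilon>"] by simp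
      then have "1 \<le> ln (1 / \<epsilon>) / ln 2" by simp
      then have "1 * 1 \<le> max 1 (ln (condition_number M)) * (ln (1 / \<epsilon>) / ln 2)"
        by (intro mult_mono) auto
      then show ?thesis
        using mult_left_mono[of 1 "max 1 (ln (condition_number M)) * (ln (1 / \<epsilon>) / ln 2)"
            "242 * (real n)\<^sup>2"]
        by (simp only: mult_1_right zero_le_mult_iff zero_le_power2 zero_le_numeral simp_thms)
    qed
    finally show ?thesis by (simp add: mult.assoc)
  qed
  ultimately show "\<exists>T \<sigma>. runs n M program (initial n M b \<epsilon>) T \<sigma> \<and>
         approx_solution n M b \<epsilon> (result n \<sigma>) \<and>
         real T \<le> 242 / ln 2 * (real n)\<^sup>2 * max 1 (ln (condition_number M)) * ln (1 / \<epsilon>)"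
    using run(1) by blast
qed simp

end
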